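(* For every $d\ge1$ and every $C_0>0$ there is a finite constant $C=C(d,C_0)$ such that the following holds. Let $(B_Q)_{Q\in\mathcal D(Q_0)}$ be a sequence of positive semidefinite $d\times d$ matrices such that $$\frac{1}{|L|}\sum_{Q\in\mathcal D(L)}B_Q\le C_0\,\mathbf 1\qquad\text{for all }L\in\mathcal D(Q_0)$$ (inequality in the sense of positive semidefinite matrices). Then for all $d\times d$ matrix weights $W$ on $Q_0$, all vectors $e\in\mathbb C^d$ and all $K\in\mathcal D(Q_0)$, $$\frac{1}{|K|}\sum_{Q\in\mathcal D(K)}\bigl\langle B_Q\langle W\rangle_K^{-1/2}\langle W^{-1}\rangle_Q^{-1/2}e,\ \langle W\rangle_K^{-1/2}\langle W^{-1}\rangle_Q^{-1/2}e\bigr\rangle_{\mathbb C^d}\le C\,\|e\|_{\mathbb C^d}^2$$ and $$\frac{1}{|K|}\sum_{Q\in\mathcal D(K)}\bigl\langle B_Q\langle W^{-1}\rangle_Q^{-1/2}\langle W\rangle_K^{-1/2}e,\ \langle W^{-1}\rangle_Q^{-1/2}\langle W\rangle_K^{-1/2}e\bigr\rangle_{\mathbb C^d}\le C\,\|e\|_{\mathbb C^d}^2 .$$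
   Context: $Q_0=[0,1]$ carries its dyadic filtration. For a dyadic interval $K\subseteq Q_0$, $\mathcal D(K)$ denotes the collection of all dyadic subintervals of $K$ (including $K$ itself), and $|K|$ is the Lebesgue measure of $K$. A $d\times d$ matrix weight on $Q_0$ is a measurable $d\times d$ (complex) matrix-valued function $W$ such that $W(x)$ is positive semidefinite for almost every $x$ and both $W$ and $W^{-1}$ are locally integrable (in particular $W(x)$ is invertible for a.e. $x$, and $W$, $W^{-1}$ are integrable on $Q_0$). For a matrix-valued function $h$, $\langle h\rangle_Q=\frac1{|Q|}\int_Q h\,dx$ is its average over $Q$; powers such as $\langle W\rangle_K^{-1/2}$ are taken after averaging. $\mathbf 1$ is the $d\times d$ identity matrix, and $\langle\cdot,\cdot\rangle_{\mathbb C^d}$ is the standard inner product. *)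

theory Defs
  imports "HOL-Analysis.Analysis"
begin

definition cinner :: "complex^'n \<Rightarrow> complex^'n \<Rightarrow> complex" where
  "cinner x y = (\<Sum>i\<in>UNIV. x $ i * cnj (y $ i))"

text \<open>Over the complex numbers, nonnegativity of the quadratic form already forces the
  matrix to be Hermitian.\<close>
definition psd :: "complex^'n^'n \<Rightarrow> bool" where
  "psd A \<longleftrightarrow> (\<forall>x. cinner (A *v x) x \<in> \<real>\<^sub>\<ge>\<^sub>0)"

definition loewner_le :: "complex^'n^'n \<Rightarrow> complex^'n^'n \<Rightarrow> bool" where
  "loewner_le A B \<longleftrightarrow> psd (B - A)"

text \<open>A positive semidefinite matrix has exactly one positive semidefinite square root;
  the following is meaningful only for positive semidefinite (respectively, positive
  semidefinite and invertible) arguments.\<close>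
definition psd_sqrt :: "complex^'n^'n \<Rightarrow> complex^'n^'n" where
  "psd_sqrt A = (THE S. psd S \<and> S ** S = A)"

definition inv_sqrt :: "complex^'n^'n \<Rightarrow> complex^'n^'n" where
  "inv_sqrt A = matrix_inv (psd_sqrt A)"

definition Q0 :: "real set" where
  "Q0 = {0..1}"

text \<open>Dyadic intervals are taken closed, in accordance with \<open>Q0 = [0,1]\<close>. Only side
  lengths at most 1 occur, since the set is used for subsets of \<open>Q0\<close> only.\<close>
definition dyadic_subintervals :: "real set \<Rightarrow> real set set" where
  "dyadic_subintervals K =
     {Q. Q \<subseteq> K \<and> (\<exists>(n::nat) (k::int). Q = {of_int k / 2 ^ n .. (of_int k + 1) / 2 ^ n})}"

definition average :: "(real \<Rightarrow> complex^'n^'n) \<Rightarrow> real set \<Rightarrow> complex^'n^'n" where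
  "average h Q = (1 / measure lebesgue Q) *\<^sub>R (LINT x:Q|lebesgue. h x)"

text \<open>The invertibility clause is needed because \<^const>\<open>matrix_inv\<close> is a total function.\<close>
definition matrix_weight :: "(real \<Rightarrow> complex^'n^'n) \<Rightarrow> bool" where
  "matrix_weight W \<longleftrightarrow>
     W \<in> borel_measurable (lebesgue_on Q0) \<and>
     (AE x in lebesgue_on Q0. psd (W x) \<and> invertible (W x)) \<and>
     W absolutely_integrable_on Q0 \<and>
     (\<lambda>x. matrix_inv (W x)) absolutely_integrable_on Q0"

text \<open>Convergence of the (unordered) series is part of the condition, because
  \<^const>\<open>infsum\<close> returns 0 for series that do not converge.\<close>
definition carleson_sequence :: "real \<Rightarrow> (real set \<Rightarrow> complex^'n^'n) \<Rightarrow> bool" where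
  "carleson_sequence C0 B \<longleftrightarrow>
     (\<forall>Q\<in>dyadic_subintervals Q0. psd (B Q)) \<and>
     (\<forall>L\<in>dyadic_subintervals Q0.
        B summable_on dyadic_subintervals L \<and>
        loewner_le ((1 / measure lebesgue L) *\<^sub>R (\<Sum>\<^sub>\<infinity>Q\<in>dyadic_subintervals L. B Q))
                   (C0 *\<^sub>R mat 1))"

text \<open>For positive semidefinite \<open>A\<close> the number \<open>cinner (A *v v) v\<close> is real, so that
  passing to the real part loses nothing.\<close>
definition quad_form :: "complex^'n^'n \<Rightarrow> complex^'n \<Rightarrow> real" where
  "quad_form A v = Re (cinner (A *v v) v)"

end

theory Submission
  imports Defs
begin

text \<open>A positive semidefinite \<open>B\<close> satisfies \<open>B \<le> d tr(B) 1\<close>, and the traces \<open>b\<^sub>Q = tr B\<^sub>Q\<close> form a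
  scalar Carleson sequence with constant \<open>d C0\<close>; so at the price of powers of \<open>d\<close> the matrices
  \<open>B\<^sub>Q\<close> may be replaced by scalars. The Frobenius norm does not change under adjoints and hence
  does not see the order of the two factors \<open>\<langle>W\<rangle>\<^sub>K\<^sup>-\<^sup>1\<^sup>/\<^sup>2\<close> and \<open>\<langle>V\<rangle>\<^sub>Q\<^sup>-\<^sup>1\<^sup>/\<^sup>2\<close>, where \<open>V = W\<^sup>-\<^sup>1\<close>. Both
  estimates therefore follow from one inequality for a fixed vector \<open>u\<close>
  (\<open>weighted_carleson_embedding\<close>):
  \<open>\<Sum>\<^sub>Q b\<^sub>Q |\<langle>V\<rangle>\<^sub>Q\<^sup>-\<^sup>1\<^sup>/\<^sup>2 u|\<^sup>2 \<le> 4 c |K| (\<langle>W\<rangle>\<^sub>K u, u)\<close>,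
  where \<open>c\<close> is the Carleson constant of \<open>b\<close>. With \<open>u = \<langle>W\<rangle>\<^sub>K\<^sup>-\<^sup>1\<^sup>/\<^sup>2 e\<close> its right-hand side is
  \<open>4 c |K| |e|\<^sup>2\<close>.

  This inequality is proved with a Bellman function. Let \<open>P\<^sub>Q = (\<langle>V\<rangle>\<^sub>Q\<^sup>-\<^sup>1 u, u)\<close>,
  \<open>w\<^sub>Q = (\<langle>W\<rangle>\<^sub>Q u, u)\<close>, and let \<open>M\<^sub>Q \<in> [1, 2]\<close> be one plus the normalised Carleson sum
  over the subintervals of \<open>Q\<close>. The function \<open>(V, M) \<mapsto> (V\<^sup>-\<^sup>1 u, u) / M\<close> is jointly convex and
  decreases in \<open>M\<close> at rate at least \<open>(V\<^sup>-\<^sup>1 u, u) / 4\<close> on that range (\<open>bellman_step\<close>). Passing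
  from \<open>Q\<close> to its two halves, \<open>\<langle>V\<rangle>\<close> and \<open>w\<close> are averaged exactly, while \<open>M\<^sub>Q\<close> exceeds the mean of
  its two successors by \<open>b\<^sub>Q / (c |Q|)\<close>. Consequently \<open>4 c |Q| (w\<^sub>Q - P\<^sub>Q / M\<^sub>Q)\<close> loses at least
  \<open>b\<^sub>Q P\<^sub>Q\<close> in each splitting. It is nonnegative because \<open>\<langle>V\<rangle>\<^sub>Q\<^sup>-\<^sup>1 \<le> \<langle>W\<rangle>\<^sub>Q\<close>
  (\<open>matrix_weight_average\<close>), so the sum of all losses is at most its initial value
  (\<open>dyadic_superadditive_summable\<close>).

  The square roots are treated for positive definite matrices only, which covers all averages of
  matrix weights. Existence comes from a contraction and uniqueness from a trace identity.\<close>

section \<open>Self-adjoint and positive definite complex matrices\<close>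

text \<open>Hermitian symmetry is expressed through the real inner product of \<open>complex^'n\<close>, which is
  the real part of \<^const>\<open>cinner\<close>; for complex-linear maps this is equivalent to symmetry for
  \<^const>\<open>cinner\<close>, and it makes the library of real inner product spaces applicable.\<close>
definition selfadj :: "complex^'n^'n \<Rightarrow> bool" where
  "selfadj A \<longleftrightarrow> (\<forall>x y. (A *v x) \<bullet> y = x \<bullet> (A *v y))"

definition posdef :: "complex^'n^'n \<Rightarrow> bool" where
  "posdef A \<longleftrightarrow> selfadj A \<and> (\<forall>x. x \<noteq> 0 \<longrightarrow> 0 < (A *v x) \<bullet> x)"

lemma inner_complex_vec: "x \<bullet> y = Re (cinner x y)" for x y :: "complex^'n"
  by (simp add: cinner_def inner_vec_def inner_complex_def)

lemma quad_form_inner: "quad_form A v = (A *v v) \<bullet> v"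
  by (simp add: quad_form_def inner_complex_vec)

lemma Im_cinner: "Im (cinner x y) = x \<bullet> (\<i> *s y)" for x y :: "complex^'n"
  by (simp add: cinner_def inner_vec_def inner_complex_def algebra_simps)

lemma i_inner_i: "(\<i> *s x) \<bullet> (\<i> *s y) = x \<bullet> y" for x y :: "complex^'n"
  by (simp add: inner_vec_def inner_complex_def algebra_simps)

lemma i_inner_left: "(\<i> *s x) \<bullet> y = - (x \<bullet> (\<i> *s y))" for x y :: "complex^'n"
  by (simp add: inner_vec_def inner_complex_def algebra_simps flip: sum_negf)

lemma matrix_i: "A *v (\<i> *s x) = \<i> *s (A *v x)" for A :: "complex^'n^'m"
  by (simp add: vector_scalar_commute)

lemma matrix_scaleR_left: "(c *\<^sub>R A) *v x = c *\<^sub>R (A *v x)" for A :: "complex^'n^'m"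
  by (simp add: matrix_vector_mult_def vec_eq_iff scaleR_sum_right)

lemma matrix_scaleR_right: "A *v (c *\<^sub>R x) = c *\<^sub>R (A *v x)" for A :: "complex^'n^'m"
  by (rule linear_scale[OF matrix_vector_mul_linear])

text \<open>The imaginary part of \<open>(A x, x)\<close> is the real inner product of \<open>A x\<close> with \<open>\<i> x\<close>.
  Polarising the condition that it vanishes gives symmetry.\<close>
lemma psd_iff: "psd A \<longleftrightarrow> selfadj A \<and> (\<forall>x. 0 \<le> (A *v x) \<bullet> x)"
proof -
  have *: "psd A \<longleftrightarrow> (\<forall>x. (A *v x) \<bullet> (\<i> *s x) = 0) \<and> (\<forall>x. 0 \<le> (A *v x) \<bullet> x)"
    by (auto simp: psd_def complex_nonneg_Reals_iff inner_complex_vec Im_cinner)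
  have "(\<forall>x. (A *v x) \<bullet> (\<i> *s x) = 0) \<longleftrightarrow> selfadj A"
  proof
    assume z: "\<forall>x. (A *v x) \<bullet> (\<i> *s x) = 0"
    have zz: "(A *v x) \<bullet> (\<i> *s y) + (A *v y) \<bullet> (\<i> *s x) = 0" for x y
      using z[rule_format, of "x + y"] z[rule_format, of x] z[rule_format, of y]
      by (simp add: algebra_simps vector_add_ldistrib inner_add)
    show "selfadj A"
      unfolding selfadj_def
    proof (intro allI)
      fix x y
      show "(A *v x) \<bullet> y = x \<bullet> (A *v y)"
        using zz[of "\<i> *s x" y]
        by (simp add: matrix_i i_inner_i inner_commute i_inner_left)
    qed
  next
    assume s: "selfadj A"
    show "\<forall>x. (A *v x) \<bullet> (\<i> *s x) = 0"
    proof
      fix x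
      have "(A *v x) \<bullet> (\<i> *s x) = x \<bullet> (\<i> *s (A *v x))"
        using s by (simp add: selfadj_def matrix_i)
      also have "\<dots> = - ((A *v x) \<bullet> (\<i> *s x))"
        by (metis i_inner_left inner_commute)
      finally show "(A *v x) \<bullet> (\<i> *s x) = 0" by simp
    qed
  qed
  with * show ?thesis by simp
qed

definition ctrans :: "complex^'n^'m \<Rightarrow> complex^'m^'n" where
  "ctrans A = (\<chi> i j. cnj (A $ j $ i))"

lemma matrix_sub_ldistrib: "A ** (B - C) = A ** B - A ** C" for A :: "'a::ring_1^'n^'m"
  by (simp add: matrix_matrix_mult_def vec_eq_iff algebra_simps sum_subtractf)

lemma matrix_sub_rdistrib: "(A - B) ** C = A ** C - B ** C" for A :: "'a::ring_1^'n^'m"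
  by (simp add: matrix_matrix_mult_def vec_eq_iff algebra_simps sum_subtractf)

lemma inner_ctrans: "(A *v x) \<bullet> y = x \<bullet> (ctrans A *v y)"
  for A :: "complex^'n^'m"
proof -
  have "(A *v x) \<bullet> y = (\<Sum>i\<in>UNIV. \<Sum>j\<in>UNIV. Re (A$i$j * x$j * cnj (y$i)))"
    by (simp add: inner_complex_vec cinner_def matrix_vector_mult_def sum_distrib_right
      del: times_complex.sel)
  also have "\<dots> = (\<Sum>j\<in>UNIV. \<Sum>i\<in>UNIV. Re (A$i$j * x$j * cnj (y$i)))"
    by (rule sum.swap)
  also have "\<dots> = x \<bullet> (ctrans A *v y)"
    by (simp add: inner_complex_vec cinner_def matrix_vector_mult_def sum_distrib_left
      ctrans_def mult_ac del: times_complex.sel)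
  finally show ?thesis .
qed

lemma matrix_eq_inner: "A = B" if "\<And>x y. (A *v x) \<bullet> y = (B *v x) \<bullet> y"
  for A B :: "complex^'n^'m"
proof -
  have "A *v x = B *v x" for x
    using that vector_eq_rdot[of "A *v x" "B *v x"] by blast
  then show ?thesis by (simp add: matrix_eq)
qed

lemma selfadj_ctrans: "selfadj A \<Longrightarrow> ctrans A = A"
  by (rule matrix_eq_inner) (metis inner_commute inner_ctrans selfadj_def)

lemma ctrans_mult: "ctrans (A ** B) = ctrans B ** ctrans A"
  by (simp add: ctrans_def matrix_matrix_mult_def vec_eq_iff mult.commute)

lemma norm_matrix_columns: "(norm M)\<^sup>2 = (\<Sum>j\<in>UNIV. (norm (M *v axis j 1))\<^sup>2)"
  for M :: "complex^'n^'m"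
proof -
  have "(norm M)\<^sup>2 = (\<Sum>i\<in>UNIV. \<Sum>j\<in>UNIV. M$i$j \<bullet> M$i$j)"
    by (simp add: power2_norm_eq_inner inner_vec_def)
  also have "\<dots> = (\<Sum>j\<in>UNIV. \<Sum>i\<in>UNIV. M$i$j \<bullet> M$i$j)"
    by (rule sum.swap)
  also have "\<dots> = (\<Sum>j\<in>UNIV. (norm (M *v axis j 1))\<^sup>2)"
    by (simp add: power2_norm_eq_inner inner_vec_def matrix_vector_mult_def axis_def if_distrib cong: if_cong)
  finally show ?thesis .
qed

lemma norm_ctrans: "norm (ctrans M) = norm M"
proof -
  have "(norm (ctrans M))\<^sup>2 = (norm M)\<^sup>2"
    unfolding power2_norm_eq_inner inner_vec_def ctrans_def
    by (subst sum.swap) (simp add: inner_complex_def)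
  then show ?thesis by simp
qed

text \<open>The norm of a matrix is the Frobenius norm, in which the identity has norm \<open>\<surd>d\<close>. For
  contraction arguments the factor on one side has to be measured by its operator norm, here
  represented by a bound \<open>c\<close>.\<close>
lemma norm_mult_left:
  fixes M :: "complex^'n^'m" and D :: "complex^'k^'n"
  assumes "\<And>x. norm (M *v x) \<le> c * norm x" "0 \<le> c"
  shows "norm (M ** D) \<le> c * norm D"
proof -
  have "(norm (M ** D))\<^sup>2 \<le> (\<Sum>j\<in>UNIV. (c * norm (D *v axis j 1))\<^sup>2)"
    unfolding norm_matrix_columns[of "M ** D"]
    by (intro sum_mono power_mono) (auto simp: assms simp flip: matrix_vector_mul_assoc)
  also have "\<dots> = (c * norm D)\<^sup>2"
    by (simp add: norm_matrix_columns power_mult_distrib sum_distrib_left)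
  finally show ?thesis
    using assms(2) by (simp add: power2_le_iff_abs_le)
qed

lemma norm_mult_right:
  fixes M D :: "complex^'n^'n"
  assumes "\<And>x. norm (M *v x) \<le> c * norm x" "0 \<le> c" "selfadj M"
  shows "norm (D ** M) \<le> c * norm D"
  using norm_mult_left[OF assms(1,2), of "ctrans D"] assms(3)
  by (metis ctrans_mult norm_ctrans selfadj_ctrans)

lemma norm_matrix_vector_le: "norm (M *v x) \<le> norm M * norm x" for M :: "complex^'n^'m"
proof -
  have comp: "norm ((M *v x)$i) \<le> norm (M$i) * norm x" for i
  proof -
    have "norm ((M *v x)$i) \<le> (\<Sum>j\<in>UNIV. \<bar>norm (M$i$j)\<bar> * \<bar>norm (x$j)\<bar>)"
      unfolding matrix_vector_mult_def by (auto intro: sum_norm_le simp: norm_mult)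
    also have "\<dots> \<le> norm (M$i) * norm x"
      unfolding norm_vec_def by (rule L2_set_mult_ineq)
    finally show ?thesis .
  qed
  have "norm (M *v x) \<le> L2_set (\<lambda>i. norm (M$i) * norm x) UNIV"
    unfolding norm_vec_def[of "M *v x"] by (rule L2_set_mono) (auto simp: comp)
  also have "\<dots> = norm M * norm x"
    by (simp add: L2_set_left_distrib norm_vec_def[of M])
  finally show ?thesis .
qed

lemma selfadj_mult_vec_bound_closed:
  "closed {Y :: complex^'n^'n. selfadj Y \<and> (\<forall>x. norm (Y *v x) \<le> c * norm x)}"
proof -
  have cont: "continuous_on UNIV (\<lambda>Y :: complex^'n^'n. Y *v x)" for x
    by (rule linear_continuous_on, rule linear_conv_bounded_linear[THEN iffD1])
       (auto intro!: linearI simp: matrix_vector_mult_add_rdistrib matrix_scaleR_left)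
  show ?thesis
    unfolding selfadj_def
    by (intro closed_Collect_conj closed_Collect_all closed_Collect_eq closed_Collect_le
        continuous_intros cont)
qed

lemma posdef_lower_bound:
  fixes A :: "complex^'n^'n"
  assumes "posdef A"
  obtains \<delta> where "0 < \<delta>" "\<And>x. \<delta> * (norm x)\<^sup>2 \<le> (A *v x) \<bullet> x"
proof -
  have "axis undefined 1 \<in> sphere (0 :: complex^'n) 1" by simp
  then have ne: "sphere (0 :: complex^'n) 1 \<noteq> {}" by blast
  have cont: "continuous_on (sphere 0 1) (\<lambda>x. (A *v x) \<bullet> x)"
    by (intro continuous_intros linear_continuous_on) auto
  from continuous_attains_inf[OF _ ne cont] obtain z
    where z: "z \<in> sphere 0 1" "\<And>y. y \<in> sphere 0 1 \<Longrightarrow> (A *v z) \<bullet> z \<le> (A *v y) \<bullet> y"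
    by auto
  show ?thesis
  proof
    have "z \<noteq> 0" using z(1) by auto
    then show "0 < (A *v z) \<bullet> z" using assms by (simp add: posdef_def)
    fix x :: "complex^'n"
    show "(A *v z) \<bullet> z * (norm x)\<^sup>2 \<le> (A *v x) \<bullet> x"
    proof (cases "x = 0")
      case False
      have "(A *v z) \<bullet> z \<le> (A *v (x /\<^sub>R norm x)) \<bullet> (x /\<^sub>R norm x)"
        by (rule z(2)) (use False in simp)
      also have "\<dots> = (A *v x) \<bullet> x / (norm x)\<^sup>2"
        by (simp add: matrix_scaleR_right power2_eq_square divide_inverse)
      finally show ?thesis using False by (simp add: field_simps)
    qed simp
  qed
qed

section \<open>Square roots of positive definite matrices\<close>

text \<open>After scaling, \<open>E = 1 - t A\<close> has operator norm \<open>c < 1\<close>. Writing the root of \<open>t A\<close> as \<open>1 - Y\<close>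
  turns the equation into \<open>Y = (E + Y\<^sup>2) / 2\<close>, whose right-hand side maps the self-adjoint matrices
  of operator norm at most \<open>c\<close> to themselves and is a \<open>c\<close>-contraction there, because
  \<open>Y\<^sup>2 - Z\<^sup>2 = Y (Y - Z) + (Y - Z) Z\<close> holds without commutativity.\<close>
lemma posdef_sqrt_exists:
  fixes A :: "complex^'n^'n"
  assumes A: "posdef A"
  shows "\<exists>S. posdef S \<and> S ** S = A"
proof -
  obtain \<delta> where d: "0 < \<delta>" "\<And>x. \<delta> * (norm x)\<^sup>2 \<le> (A *v x) \<bullet> x"
    using posdef_lower_bound[OF A] by blast
  define m where "m = norm A + \<delta> + 1"
  \<comment> \<open>This \<open>t\<close> minimises the bound \<open>1 - 2 t \<delta> + t\<^sup>2 m\<^sup>2\<close> for the squared norm of \<open>1 - t A\<close>.\<close>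
  define t where "t = \<delta> / m\<^sup>2"
  define c where "c = sqrt (1 - \<delta>\<^sup>2 / m\<^sup>2)"
  have m: "0 < m" "\<delta> < m" using d by (auto simp: m_def add_pos_nonneg add_nonneg_pos)
  have t: "0 < t" using d m by (simp add: t_def)
  have "\<delta>\<^sup>2 < m\<^sup>2" using d m by (intro power_strict_mono) auto
  then have q: "0 < \<delta>\<^sup>2 / m\<^sup>2" "\<delta>\<^sup>2 / m\<^sup>2 < 1" using d m by auto
  then have c: "0 \<le> c" "c < 1" by (auto simp: c_def)
  define E where "E = mat 1 - t *\<^sub>R A"
  have sA: "(A *v x) \<bullet> y = x \<bullet> (A *v y)" for x y using A by (auto simp: posdef_def selfadj_def)
  have Ev: "E *v x = x - t *\<^sub>R (A *v x)" for x
    by (simp add: E_def algebra_simps matrix_scaleR_left)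
  have E: "selfadj E" by (simp add: selfadj_def Ev inner_diff sA)
  have Eb: "norm (E *v x) \<le> c * norm x" for x
  proof -
    have "norm (A *v x) \<le> m * norm x"
      using norm_matrix_vector_le[of A x]
        mult_nonneg_nonneg[OF less_imp_le[OF d(1)] norm_ge_zero[of x]] norm_ge_zero[of x]
      unfolding m_def distrib_right mult_1_left by linarith
    then have Am: "(norm (A *v x))\<^sup>2 \<le> m\<^sup>2 * (norm x)\<^sup>2"
      by (metis norm_ge_zero power_mono power_mult_distrib)
    have "(norm (E *v x))\<^sup>2 = (norm x)\<^sup>2 - 2 * t * ((A *v x) \<bullet> x) + t\<^sup>2 * (norm (A *v x))\<^sup>2"
      unfolding Ev power2_norm_eq_inner
      by (simp add: inner_diff inner_commute power2_eq_square algebra_simps)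
    also have "\<dots> \<le> (norm x)\<^sup>2 - 2 * t * (\<delta> * (norm x)\<^sup>2) + t\<^sup>2 * (m\<^sup>2 * (norm x)\<^sup>2)"
      using d(2)[of x] Am t by (intro add_mono diff_mono mult_left_mono) auto
    also have "\<dots> = (c * norm x)\<^sup>2"
      using q m by (simp add: c_def t_def power_mult_distrib power2_eq_square field_simps)
    finally show ?thesis using c by (simp add: power2_le_iff_abs_le)
  qed
  define s where "s = {Y :: complex^'n^'n. selfadj Y \<and> (\<forall>x. norm (Y *v x) \<le> c * norm x)}"
  define f where "f Y = (1/2) *\<^sub>R (E + Y ** Y)" for Y :: "complex^'n^'n"
  have fv: "f Y *v x = (1/2) *\<^sub>R (E *v x + Y *v (Y *v x))" for Y x
    by (simp add: f_def matrix_scaleR_left matrix_vector_mult_add_rdistrib matrix_vector_mul_assoc)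
  have "\<exists>!Y\<in>s. f Y = Y"
  proof (rule Banach_fix)
    show "complete s" unfolding s_def complete_eq_closed by (rule selfadj_mult_vec_bound_closed)
    have "E \<in> s" by (simp add: s_def E Eb)
    then show "s \<noteq> {}" by blast
    show "f ` s \<subseteq> s"
    proof (rule image_subsetI)
      fix Y assume "Y \<in> s"
      then have Y: "selfadj Y" "\<And>x. norm (Y *v x) \<le> c * norm x" by (auto simp: s_def)
      have "selfadj (f Y)"
        using E Y(1) by (simp add: selfadj_def fv inner_add)
      moreover have "norm (f Y *v x) \<le> c * norm x" for x
      proof -
        have "norm (Y *v (Y *v x)) \<le> c * norm (Y *v x)" using Y by blast
        also have "\<dots> \<le> 1 * norm (Y *v x)" using c by (intro mult_right_mono) auto
        also have "\<dots> \<le> c * norm x" using Y by simp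
        finally show ?thesis
          using Eb[of x] norm_triangle_ineq[of "E *v x" "Y *v (Y *v x)"] by (simp add: fv)
      qed
      ultimately show "f Y \<in> s" by (simp add: s_def)
    qed
    show "0 \<le> c" "c < 1" by fact+
    show "dist (f Y) (f Z) \<le> c * dist Y Z" if "Y \<in> s" "Z \<in> s" for Y Z
    proof -
      from that have YZ: "selfadj Y" "\<And>x. norm (Y *v x) \<le> c * norm x"
        "selfadj Z" "\<And>x. norm (Z *v x) \<le> c * norm x" by (auto simp: s_def)
      have eq: "f Y - f Z = (1/2) *\<^sub>R (Y ** (Y - Z) + (Y - Z) ** Z)"
        by (simp add: f_def matrix_sub_ldistrib matrix_sub_rdistrib algebra_simps)
      have "norm (Y ** (Y - Z)) \<le> c * norm (Y - Z)" "norm ((Y - Z) ** Z) \<le> c * norm (Y - Z)"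
        using norm_mult_left[OF YZ(2) c(1)] norm_mult_right[OF YZ(4) c(1) YZ(3)] by auto
      then show "dist (f Y) (f Z) \<le> c * dist Y Z"
        using norm_triangle_ineq[of "Y ** (Y - Z)" "(Y - Z) ** Z"]
        by (simp add: dist_norm eq)
    qed
  qed
  then obtain Y where Y: "Y \<in> s" "f Y = Y" by blast
  define S where "S = (1 / sqrt t) *\<^sub>R (mat 1 - Y)"
  have Sv: "S *v x = (1 / sqrt t) *\<^sub>R (x - Y *v x)" for x
    by (simp add: S_def matrix_scaleR_left algebra_simps)
  have "0 < (x - Y *v x) \<bullet> x" if "x \<noteq> 0" for x
  proof -
    have "(Y *v x) \<bullet> x \<le> norm (Y *v x) * norm x" by (rule norm_cauchy_schwarz)
    also have "\<dots> \<le> (c * norm x) * norm x" using Y by (intro mult_right_mono) (auto simp: s_def)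
    also have "\<dots> < (1 * norm x) * norm x" using c that by (intro mult_strict_right_mono) auto
    finally show ?thesis by (simp add: inner_diff power2_norm_eq_inner flip: power2_eq_square)
  qed
  then have "posdef S"
    using Y(1) t by (auto simp: posdef_def Sv s_def selfadj_def inner_diff)
  moreover have "S ** S = A"
  proof (rule matrix_eq[THEN iffD2], rule allI)
    fix x
    have "Y *v x = (1/2) *\<^sub>R (x - t *\<^sub>R (A *v x) + Y *v (Y *v x))"
      using fv[of Y x] Y(2) by (simp add: Ev)
    then have "Y *v x + Y *v x = x - t *\<^sub>R (A *v x) + Y *v (Y *v x)"
      by (metis scaleR_half_double scaleR_right_distrib)
    then have At: "t *\<^sub>R (A *v x) = (x - Y *v x) - (Y *v x - Y *v (Y *v x))"
      by (simp add: algebra_simps)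
    have "(S ** S) *v x = (1 / t) *\<^sub>R ((x - Y *v x) - (Y *v x - Y *v (Y *v x)))"
      using t by (simp add: Sv matrix_scaleR_right matrix_vector_mult_diff_distrib
          flip: matrix_vector_mul_assoc scaleR_diff_right)
    then show "(S ** S) *v x = A *v x"
      unfolding At[symmetric] using t by simp
  qed
  ultimately show ?thesis by blast
qed

lemma posdef_kernel: "posdef A \<Longrightarrow> A *v x = 0 \<Longrightarrow> x = 0"
  by (metis inner_zero_left less_irrefl posdef_def)

lemma posdef_invertible: "posdef A \<Longrightarrow> invertible A"
  by (metis invertible_left_inverse matrix_left_invertible_ker posdef_kernel)

lemma matrix_inv_inverse:
  assumes "invertible A"
  shows "A ** matrix_inv A = mat 1" "matrix_inv A ** A = mat 1"
  using assms someI_ex[of "\<lambda>A'. A ** A' = mat 1 \<and> A' ** A = mat 1"]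
  unfolding invertible_def matrix_inv_def by auto

lemma trace_inner: "Re (trace M) = (\<Sum>i\<in>UNIV. (M *v axis i 1) \<bullet> axis i 1)"
  for M :: "complex^'n^'n"
  by (simp add: trace_def matrix_vector_mult_def axis_def if_distrib inner_complex_def
      inner_vec_def cong: if_cong)

lemma selfadj_mult_vec: "selfadj A \<Longrightarrow> (A *v x) \<bullet> y = x \<bullet> (A *v y)"
  by (simp add: selfadj_def)

lemma posdef_imp_psd: "posdef A \<Longrightarrow> psd A"
  unfolding posdef_def psd_iff by (metis inner_zero_right less_imp_le order_refl)

text \<open>With \<open>D = S - T\<close> the hypothesis says \<open>S D + D T = 0\<close>. Multiplying by \<open>D\<close> and taking traces
  gives \<open>tr (D S D) + tr (D T D) = 0\<close> with both terms nonnegative, and \<open>tr (D S D) = 0\<close>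
  forces \<open>D = 0\<close> as \<open>S\<close> is definite.\<close>
lemma psd_root_unique:
  assumes S: "posdef S" and T: "psd T" and eq: "S ** S = T ** T"
  shows "T = S"
proof -
  define D where "D = S - T"
  have S': "selfadj S" "\<And>x. 0 \<le> (S *v x) \<bullet> x"
    and T': "selfadj T" "\<And>x. 0 \<le> (T *v x) \<bullet> x"
    using posdef_imp_psd[OF S] T by (auto simp: psd_iff)
  have D: "selfadj D"
    using S' T' by (simp add: D_def selfadj_def matrix_vector_mult_diff_rdistrib inner_diff)
  have "S ** D + D ** T = 0"
    by (simp add: D_def matrix_sub_ldistrib matrix_sub_rdistrib eq)
  then have "0 = trace (D ** (S ** D + D ** T))" by (simp add: trace_def)
  also have "\<dots> = trace (D ** (S ** D)) + trace (D ** (D ** T))"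
    by (simp add: matrix_add_ldistrib trace_add)
  also have "trace (D ** (D ** T)) = trace ((D ** T) ** D)"
    by (rule trace_mul_sym)
  finally have "0 = Re (trace (D ** (S ** D))) + Re (trace ((D ** T) ** D))"
    by (metis plus_complex.sel(1) zero_complex.sel(1))
  also have "Re (trace (D ** (S ** D)))
      = (\<Sum>i\<in>UNIV. (S *v (D *v axis i 1)) \<bullet> (D *v axis i 1))"
    by (simp add: trace_inner selfadj_mult_vec[OF D] flip: matrix_vector_mul_assoc)
  also have "Re (trace ((D ** T) ** D))
      = (\<Sum>i\<in>UNIV. (T *v (D *v axis i 1)) \<bullet> (D *v axis i 1))"
    by (simp add: trace_inner selfadj_mult_vec[OF D] flip: matrix_vector_mul_assoc)
  finally have "(\<Sum>i\<in>UNIV. (S *v (D *v axis i 1)) \<bullet> (D *v axis i 1)) = 0"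
    using sum_nonneg[of UNIV "\<lambda>i. (S *v (D *v axis i 1)) \<bullet> (D *v axis i 1)"] S'
      sum_nonneg[of UNIV "\<lambda>i. (T *v (D *v axis i 1)) \<bullet> (D *v axis i 1)"] T'
    by simp
  then have "(S *v (D *v axis i 1)) \<bullet> (D *v axis i 1) = 0" for i
    using S' by (simp add: sum_nonneg_eq_0_iff)
  then have "D *v axis i 1 = 0" for i
    using S by (metis less_irrefl posdef_def)
  then have "norm D = 0"
    using norm_matrix_columns[of D] by simp
  then show ?thesis by (simp add: D_def)
qed

lemma psd_sqrt_posdef:
  assumes "posdef A"
  shows "posdef (psd_sqrt A)" "psd_sqrt A ** psd_sqrt A = A"
proof -
  obtain S where S: "posdef S" "S ** S = A" using posdef_sqrt_exists[OF assms] by blast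
  have "psd_sqrt A = S"
    unfolding psd_sqrt_def
    by (rule the_equality) (use S posdef_imp_psd psd_root_unique[OF S(1)] in auto)
  with S show "posdef (psd_sqrt A)" "psd_sqrt A ** psd_sqrt A = A" by auto
qed

lemma inv_sqrt_posdef:
  assumes A: "posdef A"
  shows "selfadj (inv_sqrt A)"
    and "A *v (inv_sqrt A *v (inv_sqrt A *v x)) = x"
    and "(A *v (inv_sqrt A *v x)) \<bullet> (inv_sqrt A *v x) = x \<bullet> x"
proof -
  define S where "S = psd_sqrt A"
  define R where "R = inv_sqrt A"
  have S: "posdef S" "S ** S = A" using psd_sqrt_posdef[OF A] by (auto simp: S_def)
  have SR: "S *v (R *v x) = x" and RS: "R *v (S *v x) = x" for x
    using matrix_inv_inverse[OF posdef_invertible[OF S(1)]]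
    by (simp_all add: R_def inv_sqrt_def S_def matrix_vector_mul_assoc)
  have sS: "selfadj S" using S by (simp add: posdef_def)
  have Av: "A *v x = S *v (S *v x)" for x
    by (simp add: matrix_vector_mul_assoc S)
  show "selfadj (inv_sqrt A)"
    unfolding R_def[symmetric]
    unfolding selfadj_def by (metis SR sS selfadj_def)
  show "A *v (inv_sqrt A *v (inv_sqrt A *v x)) = x"
    unfolding R_def[symmetric] by (simp add: Av SR)
  show "(A *v (inv_sqrt A *v x)) \<bullet> (inv_sqrt A *v x) = x \<bullet> x"
    unfolding R_def[symmetric]
    by (simp add: Av SR selfadj_mult_vec[OF sS])
qed


section \<open>Summation over dyadic intervals\<close>

definition dyadic :: "nat \<Rightarrow> int \<Rightarrow> real set" where
  "dyadic m j = {of_int j / 2 ^ m .. (of_int j + 1) / 2 ^ m}"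

lemma dyadic_subintervals_eq: "dyadic_subintervals K = {Q. Q \<subseteq> K \<and> (\<exists>m j. Q = dyadic m j)}"
  by (simp add: dyadic_subintervals_def dyadic_def)

lemma measure_dyadic: "measure lebesgue (dyadic m j) = 1 / 2 ^ m"
  by (simp add: dyadic_def field_simps)

lemma dyadic_split: "dyadic m j = dyadic (Suc m) (2 * j) \<union> dyadic (Suc m) (2 * j + 1)"
  unfolding dyadic_def by (subst ivl_disj_un_two_touch[symmetric, of _ "(2 * of_int j + 1) / 2 ^ Suc m"])
    (auto simp: field_simps)

lemma dyadic_half_subset:
  "dyadic (Suc m) (2 * j) \<subseteq> dyadic m j" "dyadic (Suc m) (2 * j + 1) \<subseteq> dyadic m j"
  using dyadic_split[of m j] by auto

lemma dyadic_mem_subintervals: "dyadic m j \<in> dyadic_subintervals K \<longleftrightarrow> dyadic m j \<subseteq> K"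
  by (auto simp: dyadic_subintervals_eq)

lemma dyadic_subintervals_mono: "K \<subseteq> L \<Longrightarrow> dyadic_subintervals K \<subseteq> dyadic_subintervals L"
  by (auto simp: dyadic_subintervals_def)

lemma dyadic_halves_inter:
  "dyadic (Suc m) (2 * j) \<inter> dyadic (Suc m) (2 * j + 1) = {(2 * of_int j + 1) / 2 ^ Suc m}"
  by (auto simp: dyadic_def field_simps)

text \<open>Inclusion of dyadic intervals in terms of their indices: \<open>d\<close> generations below \<open>j\<close> lie the
  indices from \<open>j 2\<^sup>d\<close> to \<open>(j + 1) 2\<^sup>d - 1\<close>.\<close>
lemma dyadic_subset_descendant:
  assumes "dyadic m' j' \<subseteq> dyadic m j"
  obtains d where "m' = m + d" "j * 2 ^ d \<le> j'" "j' + 1 \<le> (j + 1) * 2 ^ d"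
proof -
  have sub: "real_of_int j / 2 ^ m \<le> real_of_int j' / 2 ^ m'"
      "(real_of_int j' + 1) / 2 ^ m' \<le> (real_of_int j + 1) / 2 ^ m"
    using assms unfolding dyadic_def by (auto simp: atLeastatMost_subset_iff divide_right_mono)
  then have "1 / 2 ^ m' \<le> (1 :: real) / 2 ^ m" by (simp add: add_divide_distrib)
  then have "(2::real) ^ m \<le> 2 ^ m'" by (simp add: field_simps)
  then have "m \<le> m'" by simp
  then obtain d where d: "m' = m + d" using le_Suc_ex by blast
  have scale: "x / 2 ^ m' * 2 ^ (m + d) = x" "x / 2 ^ m * 2 ^ (m + d) = x * 2 ^ d" for x :: real
    by (simp_all add: d power_add)
  have "real_of_int (j * 2 ^ d) \<le> real_of_int j'"
    "real_of_int (j' + 1) \<le> real_of_int ((j + 1) * 2 ^ d)"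
    using mult_right_mono[OF sub(1), of "2 ^ (m + d)"] mult_right_mono[OF sub(2), of "2 ^ (m + d)"]
    unfolding scale by simp_all
  then have "j * 2 ^ d \<le> j'" "j' + 1 \<le> (j + 1) * 2 ^ d" by (simp_all only: of_int_le_iff)
  with d that show thesis by blast
qed

text \<open>The descendants of an interval in its first \<open>N\<close> generations; they exhaust its dyadic
  subintervals by finite sets, along which induction is possible.\<close>
fun dyadic_tree :: "nat \<Rightarrow> nat \<Rightarrow> int \<Rightarrow> real set set" where
  "dyadic_tree 0 m j = {}"
| "dyadic_tree (Suc N) m j =
     insert (dyadic m j) (dyadic_tree N (Suc m) (2 * j) \<union> dyadic_tree N (Suc m) (2 * j + 1))"

lemma finite_dyadic_tree: "finite (dyadic_tree N m j)"
  by (induction N m j rule: dyadic_tree.induct) auto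

lemma dyadic_in_tree:
  assumes "j * 2 ^ d \<le> j'" "j' + 1 \<le> (j + 1) * 2 ^ d" "d < N"
  shows "dyadic (m + d) j' \<in> dyadic_tree N m j"
  using assms
proof (induction N arbitrary: d m j)
  case (Suc N)
  show ?case
  proof (cases d)
    case 0
    with Suc.prems have "j' = j" by simp
    with 0 show ?thesis by simp
  next
    case d: (Suc d')
    show ?thesis
    proof (cases "j' + 1 \<le> (2 * j + 1) * 2 ^ d'")
      case True
      then have "dyadic (Suc m + d') j' \<in> dyadic_tree N (Suc m) (2 * j)"
        using Suc.prems d by (intro Suc.IH) (auto simp: algebra_simps)
      with d show ?thesis by simp
    next
      case False
      then have "dyadic (Suc m + d') j' \<in> dyadic_tree N (Suc m) (2 * j + 1)"
        using Suc.prems d by (intro Suc.IH) (auto simp: algebra_simps)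
      with d show ?thesis by simp
    qed
  qed
qed simp

lemma finite_subset_dyadic_tree:
  assumes "finite F" "F \<subseteq> dyadic_subintervals (dyadic m j)"
  shows "\<exists>N. F \<subseteq> dyadic_tree N m j"
  using assms
proof (induction F)
  case (insert Q F)
  then obtain N where N: "F \<subseteq> dyadic_tree N m j" by auto
  from insert.prems obtain m' j' where Q: "Q = dyadic m' j'" "dyadic m' j' \<subseteq> dyadic m j"
    by (auto simp: dyadic_subintervals_eq)
  obtain d where d: "m' = m + d" "j * 2 ^ d \<le> j'" "j' + 1 \<le> (j + 1) * 2 ^ d"
    using dyadic_subset_descendant[OF Q(2)] .
  have "Q \<in> dyadic_tree (max N (Suc d)) m j"
    unfolding Q(1) d(1) by (rule dyadic_in_tree) (use d in auto)
  moreover have "dyadic_tree N m j \<subseteq> dyadic_tree (max N (Suc d)) m j"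
  proof -
    have "dyadic_tree N m j \<subseteq> dyadic_tree (N + k) m j" for N k
      by (induction N m j rule: dyadic_tree.induct) auto
    from this[of N "max N (Suc d) - N"] show ?thesis by simp
  qed
  ultimately show ?case using N by blast
qed auto

text \<open>If \<open>G\<close> is nonnegative and loses at least \<open>a\<close> whenever an interval is halved, then what is
  lost over finitely many generations cannot exceed the initial value of \<open>G\<close>.\<close>
lemma dyadic_superadditive_summable:
  fixes a G :: "real set \<Rightarrow> real"
  assumes K: "dyadic m j \<subseteq> Q0"
    and a: "\<And>Q. Q \<in> dyadic_subintervals Q0 \<Longrightarrow> 0 \<le> a Q"
    and G: "\<And>Q. Q \<in> dyadic_subintervals Q0 \<Longrightarrow> 0 \<le> G Q"
    and step: "\<And>m j. dyadic m j \<subseteq> Q0 \<Longrightarrow>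
      a (dyadic m j) + G (dyadic (Suc m) (2 * j)) + G (dyadic (Suc m) (2 * j + 1)) \<le> G (dyadic m j)"
  shows "a summable_on dyadic_subintervals (dyadic m j)"
    and "(\<Sum>\<^sub>\<infinity>Q\<in>dyadic_subintervals (dyadic m j). a Q) \<le> G (dyadic m j)"
proof -
  have tree_sub: "dyadic_tree N m j \<subseteq> dyadic_subintervals (dyadic m j)" for N m j
  proof (induction N m j rule: dyadic_tree.induct)
    case (2 N m j)
    then show ?case
      using dyadic_half_subset[THEN dyadic_subintervals_mono, of m j]
      by (simp add: dyadic_mem_subintervals) blast
  qed simp
  have tree: "sum a (dyadic_tree N m j) \<le> G (dyadic m j)" if "dyadic m j \<subseteq> Q0" for N m j
    using that
  proof (induction N m j rule: dyadic_tree.induct)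
    case (1 m j)
    then show ?case using G by (simp add: dyadic_mem_subintervals)
  next
    case (2 N m j)
    let ?L = "dyadic_tree N (Suc m) (2 * j)" and ?R = "dyadic_tree N (Suc m) (2 * j + 1)"
    have sub: "dyadic (Suc m) (2 * j) \<subseteq> Q0" "dyadic (Suc m) (2 * j + 1) \<subseteq> Q0"
      using dyadic_half_subset[of m j] 2(3) by blast+
    have a': "0 \<le> a Q" if "Q \<in> insert (dyadic m j) (?L \<union> ?R)" for Q
      using that a tree_sub[of "Suc N" m j] dyadic_subintervals_mono[OF 2(3)]
      unfolding dyadic_tree.simps by blast
    have "sum a (dyadic_tree (Suc N) m j) \<le> a (dyadic m j) + sum a (?L \<union> ?R)"
      using a' by (simp add: sum.insert_if finite_dyadic_tree)
    also have "sum a (?L \<union> ?R) \<le> sum a ?L + sum a ?R"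
      using a' by (subst sum_Un) (auto simp: finite_dyadic_tree intro!: sum_nonneg)
    also have "a (dyadic m j) + (sum a ?L + sum a ?R) \<le> G (dyadic m j)"
      using 2(1)[OF sub(1)] 2(2)[OF sub(2)] step[OF 2(3)] by linarith
    finally show ?case by simp
  qed
  have a': "0 \<le> a Q" if "Q \<in> dyadic_subintervals (dyadic m j)" for Q
    using that dyadic_subintervals_mono[OF K] a by blast
  have fin: "sum a F \<le> G (dyadic m j)" if F: "finite F" "F \<subseteq> dyadic_subintervals (dyadic m j)" for F
  proof -
    obtain N where "F \<subseteq> dyadic_tree N m j" using finite_subset_dyadic_tree[OF F] by blast
    then have "sum a F \<le> sum a (dyadic_tree N m j)"
      using subsetD[OF tree_sub] by (intro sum_mono2 a') (auto simp: finite_dyadic_tree)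
    with tree[OF K] show ?thesis by (meson order_trans)
  qed
  show *: "a summable_on dyadic_subintervals (dyadic m j)"
    by (rule nonneg_bdd_above_summable_on) (use a' fin in \<open>auto intro!: bdd_aboveI2\<close>)
  show "(\<Sum>\<^sub>\<infinity>Q\<in>dyadic_subintervals (dyadic m j). a Q) \<le> G (dyadic m j)"
    by (rule infsum_le_finite_sums[OF *]) (use fin in auto)
qed

text \<open>An interval and the subintervals of its two halves are pairwise distinct, since two closed
  halves meet in one point only.\<close>
lemma infsum_dyadic_split:
  fixes b :: "real set \<Rightarrow> real"
  assumes "b summable_on dyadic_subintervals (dyadic m j)"
    and "\<And>Q. Q \<in> dyadic_subintervals (dyadic m j) \<Longrightarrow> 0 \<le> b Q"
  shows "b (dyadic m j) + (\<Sum>\<^sub>\<infinity>Q\<in>dyadic_subintervals (dyadic (Suc m) (2 * j)). b Q)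
      + (\<Sum>\<^sub>\<infinity>Q\<in>dyadic_subintervals (dyadic (Suc m) (2 * j + 1)). b Q)
    \<le> (\<Sum>\<^sub>\<infinity>Q\<in>dyadic_subintervals (dyadic m j). b Q)"
proof -
  let ?I = "dyadic m j"
  let ?L = "dyadic_subintervals (dyadic (Suc m) (2 * j))"
  let ?R = "dyadic_subintervals (dyadic (Suc m) (2 * j + 1))"
  have notin: "?I \<notin> ?L \<union> ?R"
    by (auto simp: dyadic_subintervals_eq elim: dyadic_subset_descendant)
  have disj: "?L \<inter> ?R = {}"
  proof (rule ccontr)
    assume "?L \<inter> ?R \<noteq> {}"
    then obtain m' j' where "dyadic m' j' \<subseteq> {(2 * of_int j + 1) / 2 ^ Suc m}"
      unfolding dyadic_halves_inter[symmetric] by (auto simp: dyadic_subintervals_eq)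
    then have "real_of_int j' / 2 ^ m' = (real_of_int j' + 1) / 2 ^ m'"
      unfolding dyadic_def by (auto simp: divide_right_mono dest!: subset_singletonD)
    then show False by simp
  qed
  have sub: "?L \<subseteq> dyadic_subintervals ?I" "?R \<subseteq> dyadic_subintervals ?I" "?I \<in> dyadic_subintervals ?I"
    using dyadic_half_subset[THEN dyadic_subintervals_mono, of m j]
    by (simp_all add: dyadic_mem_subintervals)
  have summ: "b summable_on S" if "S \<subseteq> dyadic_subintervals ?I" for S
    using summable_on_subset_banach[OF assms(1) that] .
  have "b ?I + infsum b ?L + infsum b ?R = infsum b {?I} + infsum b (?L \<union> ?R)"
    using disj sub by (simp add: infsum_Un_disjoint summ)
  also have "\<dots> = infsum b ({?I} \<union> (?L \<union> ?R))"
    using notin sub by (subst infsum_Un_disjoint[of b "{?I}" "?L \<union> ?R"]) (auto intro!: summ)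
  also have "\<dots> \<le> infsum b (dyadic_subintervals ?I)"
    using sub assms(2) by (intro infsum_mono2 summ) auto
  finally show ?thesis .
qed


section \<open>Averages of matrix weights\<close>

lemma posdef_dual_bound:
  assumes "posdef A" "A *v y = u"
  shows "2 * (u \<bullet> x) \<le> (A *v x) \<bullet> x + y \<bullet> u"
proof -
  have A: "selfadj A" "0 \<le> (A *v (x - y)) \<bullet> (x - y)"
    using posdef_imp_psd[OF assms(1)] unfolding psd_iff by auto
  have "(A *v (x - y)) \<bullet> (x - y) = (A *v x) \<bullet> x - 2 * (u \<bullet> x) + y \<bullet> u"
    using selfadj_mult_vec[OF A(1), of x y] assms(2)
    by (simp add: matrix_vector_mult_diff_distrib inner_diff inner_commute)
  with A(2) show ?thesis by simp
qed

text \<open>The second inequality is \<open>0 \<le> (A (y - u), y - u)\<close> for \<open>y = A\<^sup>-\<^sup>1 x\<close>. It is linear in the pair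
  \<open>(A\<^sup>-\<^sup>1, A)\<close>, so it survives averaging.\<close>
lemma psd_matrix_inv:
  assumes "psd A" "invertible A"
  shows "psd (matrix_inv A)"
    and "2 * (u \<bullet> x) \<le> (matrix_inv A *v x) \<bullet> x + (A *v u) \<bullet> u"
proof -
  let ?V = "matrix_inv A"
  have A: "selfadj A" "\<And>x. 0 \<le> (A *v x) \<bullet> x" using assms(1) by (auto simp: psd_iff)
  have AV: "A *v (?V *v x) = x" and VA: "?V *v (A *v x) = x" for x
    using matrix_inv_inverse[OF assms(2)] by (simp_all add: matrix_vector_mul_assoc)
  show "psd ?V"
    unfolding psd_iff selfadj_def by (metis A AV inner_commute selfadj_def)
  have "0 \<le> (A *v (?V *v x - u)) \<bullet> (?V *v x - u)" by (rule A)
  also have "\<dots> = (?V *v x) \<bullet> x + (A *v u) \<bullet> u - 2 * (u \<bullet> x)"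
    using selfadj_mult_vec[OF A(1), of u "?V *v x"]
    by (simp add: matrix_vector_mult_diff_distrib inner_diff inner_commute AV)
  finally show "2 * (u \<bullet> x) \<le> (?V *v x) \<bullet> x + (A *v u) \<bullet> u" by simp
qed

text \<open>\<open>(A\<^sup>-\<^sup>1 u, u)\<close> is the maximum over \<open>x\<close> of \<open>2 (u, x) - (A x, x)\<close>, attained at \<open>x = A\<^sup>-\<^sup>1 u\<close>. As
  a supremum of functions affine in \<open>A\<close> it is convex in \<open>A\<close>.\<close>
lemma inv_sqrt_quad_variational:
  assumes "posdef A"
  defines "R \<equiv> inv_sqrt A"
  shows "2 * (u \<bullet> x) - (A *v x) \<bullet> x \<le> (norm (R *v u))\<^sup>2"
    and "(A *v (R *v (R *v u))) \<bullet> (R *v (R *v u)) = (norm (R *v u))\<^sup>2"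
    and "u \<bullet> (R *v (R *v u)) = (norm (R *v u))\<^sup>2"
proof -
  note R = inv_sqrt_posdef[OF assms(1), folded R_def]
  show 1: "u \<bullet> (R *v (R *v u)) = (norm (R *v u))\<^sup>2"
    using selfadj_mult_vec[OF R(1)] by (simp add: power2_norm_eq_inner)
  show "(A *v (R *v (R *v u))) \<bullet> (R *v (R *v u)) = (norm (R *v u))\<^sup>2"
    using 1 by (simp add: R)
  show "2 * (u \<bullet> x) - (A *v x) \<bullet> x \<le> (norm (R *v u))\<^sup>2"
    using posdef_dual_bound[OF assms(1) R(2)[of u], of x] 1 by (simp add: inner_commute)
qed

lemma average_inner:
  fixes h :: "real \<Rightarrow> complex^'n^'n"
  assumes "set_integrable lebesgue Q h"
  shows "set_integrable lebesgue Q (\<lambda>t. (h t *v x) \<bullet> y)"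
    and "(average h Q *v x) \<bullet> y = (LINT t:Q|lebesgue. (h t *v x) \<bullet> y) / measure lebesgue Q"
proof -
  have bl: "bounded_linear (\<lambda>M :: complex^'n^'n. (M *v x) \<bullet> y)"
    by (rule linear_conv_bounded_linear[THEN iffD1])
       (auto intro!: linearI simp: matrix_vector_mult_add_rdistrib matrix_scaleR_left inner_add)
  have eq: "indicat_real Q t *\<^sub>R ((h t *v x) \<bullet> y) = ((indicat_real Q t *\<^sub>R h t) *v x) \<bullet> y" for t
    by (simp add: matrix_scaleR_left)
  show "set_integrable lebesgue Q (\<lambda>t. (h t *v x) \<bullet> y)"
    using integrable_bounded_linear[OF bl assms[unfolded set_integrable_def]]
    unfolding set_integrable_def eq .
  show "(average h Q *v x) \<bullet> y = (LINT t:Q|lebesgue. (h t *v x) \<bullet> y) / measure lebesgue Q"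
    using integral_bounded_linear[OF bl assms[unfolded set_integrable_def]]
    unfolding average_def set_lebesgue_integral_def eq
    by (simp add: matrix_scaleR_left)
qed

lemma average_split:
  fixes h :: "real \<Rightarrow> complex^'n^'n"
  assumes "set_integrable lebesgue (dyadic m j) h"
  shows "average h (dyadic m j) = (1/2) *\<^sub>R
    (average h (dyadic (Suc m) (2 * j)) + average h (dyadic (Suc m) (2 * j + 1)))"
proof -
  have sets: "dyadic m j \<in> sets lebesgue" for m j by (simp add: dyadic_def)
  have int: "set_integrable lebesgue (dyadic (Suc m) (2 * j)) h"
    "set_integrable lebesgue (dyadic (Suc m) (2 * j + 1)) h"
    using assms sets dyadic_half_subset by (blast intro: set_integrable_subset)+
  have "AE t in lebesgue. t \<noteq> (2 * of_int j + 1) / (2 ^ Suc m :: real)"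
    using AE_not_in[of "{(2 * of_int j + 1) / 2 ^ Suc m}" "lebesgue :: real measure"]
      negligible_sing[of "(2 * real_of_int j + 1) / 2 ^ Suc m"]
    unfolding negligible_iff_null_sets by simp
  then have "AE t in lebesgue. \<not> (t \<in> dyadic (Suc m) (2 * j) \<and> t \<in> dyadic (Suc m) (2 * j + 1))"
    using dyadic_halves_inter[of m j] by (auto elim!: eventually_mono)
  from set_integral_Un_AE[OF this sets sets int]
  show ?thesis
    unfolding average_def dyadic_split[of m j, symmetric] measure_dyadic
    by (simp add: scaleR_add_right)
qed

text \<open>The last inequality is the integrated form of the one for a matrix and its inverse. Taking
  the maximum over \<open>x\<close> in it gives \<open>\<langle>V\<rangle>\<^sup>-\<^sup>1 \<le> \<langle>W\<rangle>\<close>; it also yields definiteness of both averages.\<close>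
lemma matrix_weight_average:
  fixes W :: "real \<Rightarrow> complex^'n^'n"
  assumes W: "matrix_weight W" and Q: "dyadic m j \<subseteq> Q0"
  defines "V \<equiv> \<lambda>x. matrix_inv (W x)"
  shows "set_integrable lebesgue (dyadic m j) W" "set_integrable lebesgue (dyadic m j) V"
    and "posdef (average W (dyadic m j))" "posdef (average V (dyadic m j))"
    and "2 * (u \<bullet> x) \<le> (average V (dyadic m j) *v x) \<bullet> x + (average W (dyadic m j) *v u) \<bullet> u"
proof -
  let ?Q = "dyadic m j"
  have sets: "?Q \<in> sets lebesgue" by (simp add: dyadic_def)
  have pos: "0 < measure lebesgue ?Q" by (simp add: measure_dyadic)
  have int0: "set_integrable lebesgue Q0 W" "set_integrable lebesgue Q0 V"
    using W by (auto simp: matrix_weight_def V_def)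
  show intW: "set_integrable lebesgue ?Q W" and intV: "set_integrable lebesgue ?Q V"
    using int0 Q sets by (blast intro: set_integrable_subset)+
  have "AE t in lebesgue_on Q0. psd (W t) \<and> invertible (W t)"
    using W by (simp add: matrix_weight_def)
  then have AE: "AE t\<in>?Q in lebesgue. psd (W t) \<and> invertible (W t)"
    using Q by (subst (asm) AE_restrict_space_iff) (auto simp: Q0_def elim!: eventually_mono)
  have av: "(average W ?Q *v x) \<bullet> y = (LINT t:?Q|lebesgue. (W t *v x) \<bullet> y) / measure lebesgue ?Q"
     "(average V ?Q *v x) \<bullet> y = (LINT t:?Q|lebesgue. (V t *v x) \<bullet> y) / measure lebesgue ?Q" for x y
    using average_inner(2)[OF intW] average_inner(2)[OF intV] by auto
  note int = average_inner(1)[OF intW] average_inner(1)[OF intV]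
  have average_selfadj: "selfadj (average h ?Q)" if h: "set_integrable lebesgue ?Q h"
      and psd: "AE t\<in>?Q in lebesgue. psd (h t)" for h :: "real \<Rightarrow> complex^'n^'n"
    unfolding selfadj_def
  proof (intro allI)
    fix x y
    have "AE t\<in>?Q in lebesgue. (h t *v x) \<bullet> y = (h t *v y) \<bullet> x"
      using psd by (auto elim!: eventually_mono simp: psd_iff selfadj_def inner_commute)
    then have "(LINT t:?Q|lebesgue. (h t *v x) \<bullet> y) = (LINT t:?Q|lebesgue. (h t *v y) \<bullet> x)"
      using average_inner(1)[OF h] sets
      by (intro antisym set_integral_mono_AE) (auto elim!: eventually_mono)
    then have "(average h ?Q *v x) \<bullet> y = (average h ?Q *v y) \<bullet> x"
      by (simp add: average_inner(2)[OF h])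
    then show "(average h ?Q *v x) \<bullet> y = x \<bullet> (average h ?Q *v y)"
      by (simp add: inner_commute)
  qed
  have ind: "integrable lebesgue (indicat_real ?Q)"
    by (simp add: dyadic_def flip: lmeasurable_iff_integrable)
  have dual: "2 * (u \<bullet> x) \<le> (average V ?Q *v x) \<bullet> x + (average W ?Q *v u) \<bullet> u" for u x
  proof -
    have "(LINT t:?Q|lebesgue. 2 * (u \<bullet> x)) \<le> (LINT t:?Q|lebesgue. (V t *v x) \<bullet> x + (W t *v u) \<bullet> u)"
    proof (rule set_integral_mono_AE)
      show "set_integrable lebesgue ?Q (\<lambda>t. 2 * (u \<bullet> x))"
        using ind by (simp add: set_integrable_def)
      show "set_integrable lebesgue ?Q (\<lambda>t. (V t *v x) \<bullet> x + (W t *v u) \<bullet> u)"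
        by (intro set_integral_add int)
      show "AE t\<in>?Q in lebesgue. 2 * (u \<bullet> x) \<le> (V t *v x) \<bullet> x + (W t *v u) \<bullet> u"
        using AE by (auto elim!: eventually_mono simp: V_def intro: psd_matrix_inv(2))
    qed
    also have "\<dots> = (LINT t:?Q|lebesgue. (V t *v x) \<bullet> x) + (LINT t:?Q|lebesgue. (W t *v u) \<bullet> u)"
      by (intro set_integral_add int)
    finally have "measure lebesgue ?Q * (2 * (u \<bullet> x)) \<le> \<dots>"
      by (simp add: set_lebesgue_integral_def mult_ac)
    then show ?thesis
      unfolding av using pos by (simp add: field_simps)
  qed
  then show "2 * (u \<bullet> x) \<le> (average V ?Q *v x) \<bullet> x + (average W ?Q *v u) \<bullet> u" .
  \<comment> \<open>Inserting a small multiple \<open>r x\<close> for \<open>u\<close>, the linear term dominates the quadratic one.\<close>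
  have positive: "0 < (A *v x) \<bullet> x"
    if "\<And>x u. 2 * (u \<bullet> x) \<le> (A *v x) \<bullet> x + (B *v u) \<bullet> u" "x \<noteq> 0"
    for A B :: "complex^'n^'n" and x
  proof -
    define b where "b = \<bar>(B *v x) \<bullet> x\<bar> + 1"
    define r where "r = (x \<bullet> x) / b"
    have b: "0 < b" by (simp add: b_def)
    have r: "0 < r" using that(2) b by (simp add: r_def)
    have "2 * (r * (x \<bullet> x)) \<le> (A *v x) \<bullet> x + r * r * ((B *v x) \<bullet> x)"
      using that(1)[of "r *\<^sub>R x" x] by (simp add: matrix_scaleR_right)
    also have "\<dots> \<le> (A *v x) \<bullet> x + r * r * b"
      using r by (intro add_left_mono mult_left_mono) (auto simp: b_def)
    also have "r * r * b = r * (x \<bullet> x)" using b by (simp add: r_def)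
    finally have "r * (x \<bullet> x) \<le> (A *v x) \<bullet> x" by simp
    with r that(2) show ?thesis by (smt (verit) inner_gt_zero_iff mult_pos_pos)
  qed
  have "AE t\<in>?Q in lebesgue. psd (V t)"
    using AE by (auto elim!: eventually_mono simp: V_def intro: psd_matrix_inv(1))
  then show "posdef (average V ?Q)"
    unfolding posdef_def using average_selfadj[OF intV] positive[OF dual] by blast
  have dual': "2 * (u \<bullet> x) \<le> (average W ?Q *v x) \<bullet> x + (average V ?Q *v u) \<bullet> u" for u x
    using dual[of x u] by (simp add: inner_commute)
  have "AE t\<in>?Q in lebesgue. psd (W t)"
    using AE by (auto elim!: eventually_mono)
  then show "posdef (average W ?Q)"
    unfolding posdef_def using average_selfadj[OF intW] positive[OF dual'] by blast
qed


section \<open>The Bellman function\<close>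

text \<open>Midpoint convexity of \<open>(a, m) \<mapsto> 1 / (a m)\<close>, by the inequality of arithmetic and geometric
  means applied to the two summands on the right, to \<open>a1, a2\<close> and to \<open>m1, m2\<close>.\<close>
lemma inverse_product_midpoint_convex:
  fixes a1 a2 m1 m2 :: real
  assumes "0 < a1" "0 < a2" "0 < m1" "0 < m2"
  shows "8 / ((a1 + a2) * (m1 + m2)) \<le> 1 / (a1 * m1) + 1 / (a2 * m2)"
proof -
  define x y where "x = 1 / (a1 * m1)" and "y = 1 / (a2 * m2)"
  have xy: "0 < x" "0 < y" using assms by (auto simp: x_def y_def)
  have arith: "x * y \<le> ((x + y) / 2)\<^sup>2"
    using zero_le_power2[of "x - y"] by (simp add: power2_eq_square field_simps)
  have "4 * (a1 * a2) \<le> (a1 + a2)\<^sup>2" "4 * (m1 * m2) \<le> (m1 + m2)\<^sup>2"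
    using sum_squares_ge_zero[of "a1 - a2" 0] sum_squares_ge_zero[of "m1 - m2" 0]
    by (auto simp: power2_eq_square algebra_simps)
  then have "(4 * (a1 * a2)) * (4 * (m1 * m2)) \<le> (a1 + a2)\<^sup>2 * (m1 + m2)\<^sup>2"
    using assms by (intro mult_mono) auto
  then have "16 * (a1 * a2 * m1 * m2) * (x * y) \<le> ((a1 + a2) * (m1 + m2))\<^sup>2 * (x * y)"
    using xy by (intro mult_right_mono) (auto simp: power_mult_distrib mult_ac)
  then have "16 \<le> ((a1 + a2) * (m1 + m2))\<^sup>2 * (x * y)"
    using assms by (simp add: x_def y_def)
  also have "\<dots> \<le> ((a1 + a2) * (m1 + m2))\<^sup>2 * ((x + y) / 2)\<^sup>2"
    by (intro mult_left_mono arith) auto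
  also have "16 = (4 :: real)\<^sup>2" by simp
  finally have "4\<^sup>2 \<le> ((a1 + a2) * (m1 + m2) * ((x + y) / 2))\<^sup>2"
    by (simp only: power_mult_distrib)
  then have "4 \<le> (a1 + a2) * (m1 + m2) * ((x + y) / 2)"
    by (rule power2_le_imp_le) (use assms xy in auto)
  then have "8 \<le> (x + y) * ((a1 + a2) * (m1 + m2))" by (simp add: mult_ac)
  then have "8 / ((a1 + a2) * (m1 + m2)) \<le> x + y"
    using assms by (simp add: divide_le_eq)
  then show ?thesis by (simp add: x_def y_def)
qed

text \<open>Let \<open>y = A\<^sup>-\<^sup>1 u\<close> and \<open>p = (A\<^sup>-\<^sup>1 u, u) = (A y, y)\<close>. Testing the variational formula for \<open>A1\<close> and \<open>A2\<close>
  with multiples of \<open>y\<close> bounds their quadratic forms below by \<open>p\<^sup>2 / (A1 y, y)\<close> and \<open>p\<^sup>2 / (A2 y, y)\<close>, where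
  the two denominators have mean \<open>p\<close>; the claim is thus reduced to scalars.
  The term with \<open>\<beta>\<close> comes from the excess of \<open>m\<close> over \<open>(m1 + m2) / 2\<close>.\<close>
lemma bellman_step:
  fixes A A1 A2 :: "complex^'n^'n"
  assumes A: "posdef A" "posdef A1" "posdef A2" "A = (1/2) *\<^sub>R (A1 + A2)"
    and m: "0 < m1" "0 < m2" "m1 + m2 + 2 * \<beta> \<le> 2 * m" "0 \<le> \<beta>" "m \<le> 2"
  shows "(norm (inv_sqrt A *v u))\<^sup>2 / m + \<beta> * (norm (inv_sqrt A *v u))\<^sup>2 / 4
    \<le> ((norm (inv_sqrt A1 *v u))\<^sup>2 / m1 + (norm (inv_sqrt A2 *v u))\<^sup>2 / m2) / 2"
proof -
  define p where "p = (norm (inv_sqrt A *v u))\<^sup>2"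
  define y where "y = inv_sqrt A *v (inv_sqrt A *v u)"
  define a1 a2 where "a1 = (A1 *v y) \<bullet> y" and "a2 = (A2 *v y) \<bullet> y"
  have y: "(A *v y) \<bullet> y = p" "u \<bullet> y = p"
    using inv_sqrt_quad_variational(2,3)[OF A(1), of u] by (simp_all add: y_def p_def)
  have p: "0 \<le> p" by (simp add: p_def)
  show ?thesis
  proof (cases "p = 0")
    case True
    then show ?thesis using m by (simp flip: p_def)
  next
    case False
    then have "y \<noteq> 0" using y by auto
    then have a: "0 < a1" "0 < a2" using A by (auto simp: a1_def a2_def posdef_def)
    have sum: "a1 + a2 = 2 * p"
      using y(1) unfolding A(4) a1_def a2_def
      by (simp add: matrix_scaleR_left matrix_vector_mult_add_rdistrib inner_add)
    have opt: "p\<^sup>2 / ((B *v y) \<bullet> y) \<le> (norm (inv_sqrt B *v u))\<^sup>2"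
      if "posdef B" "0 < (B *v y) \<bullet> y" for B :: "complex^'n^'n"
      \<comment> \<open>the optimal multiple of \<open>y\<close>\<close>
      using inv_sqrt_quad_variational(1)[OF that(1), of u "(p / ((B *v y) \<bullet> y)) *\<^sub>R y"] that(2)
      by (simp add: matrix_scaleR_right y(2) power2_eq_square)
    have mm: "0 < m1 + m2" "0 < m" "(m1 + m2) / 2 \<le> 2" "\<beta> \<le> m - (m1 + m2) / 2"
      using m by (simp_all add: field_simps)
    have "p / ((m1 + m2) / 2) = p\<^sup>2 * (8 / ((a1 + a2) * (m1 + m2))) / 2"
    proof -
      have "p / (M / 2) = p\<^sup>2 * (8 / ((2 * p) * M)) / 2" if "0 < M" for M
        using False that by (simp add: power2_eq_square)
      with mm(1) show ?thesis unfolding sum by blast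
    qed
    also have "\<dots> \<le> p\<^sup>2 * (1 / (a1 * m1) + 1 / (a2 * m2)) / 2"
      using inverse_product_midpoint_convex[OF a m(1,2)]
      by (intro divide_right_mono mult_left_mono) auto
    also have "\<dots> = (p\<^sup>2 / a1 / m1 + p\<^sup>2 / a2 / m2) / 2"
      by (simp add: distrib_left)
    also have "\<dots> \<le> ((norm (inv_sqrt A1 *v u))\<^sup>2 / m1 + (norm (inv_sqrt A2 *v u))\<^sup>2 / m2) / 2"
      using opt[OF A(2)] opt[OF A(3)] a m(1,2)
      by (intro divide_right_mono add_mono) (auto simp: a1_def a2_def)
    finally have main: "p / ((m1 + m2) / 2) \<le> \<dots>" .
    have "\<beta> * p / 4 \<le> \<beta> * p / (m * ((m1 + m2) / 2))"
      using m(4) p mult_mono[OF m(5) mm(3)] mm by (intro divide_left_mono) auto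
    also have "\<dots> \<le> (m - (m1 + m2) / 2) * p / (m * ((m1 + m2) / 2))"
      using m p mm by (intro divide_right_mono mult_right_mono) auto
    also have "\<dots> = p / ((m1 + m2) / 2) - p / m"
    proof -
      have "(m - r) * p / (m * r) = p / r - p / m" if "0 < r" for r
        using that mm(2) by (simp add: field_simps)
      from this[OF half_gt_zero[OF mm(1)]] show ?thesis .
    qed
    finally show ?thesis using main by (simp flip: p_def)
  qed
qed

text \<open>\<open>G\<close> below is the Bellman quantity of the introduction, with \<open>M\<close> between 1 and 2 by the Carleson
  condition. On an interval \<open>Q\<close>, \<open>M\<close> exceeds its mean over the two halves by at least
  \<open>\<beta> = b\<^sub>Q / (c |Q|)\<close>.\<close>
lemma weighted_carleson_embedding:
  fixes W :: "real \<Rightarrow> complex^'n^'n" and b :: "real set \<Rightarrow> real" and u :: "complex^'n"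
  defines "a \<equiv> \<lambda>Q. b Q * (norm (inv_sqrt (average (\<lambda>x. matrix_inv (W x)) Q) *v u))\<^sup>2"
  assumes W: "matrix_weight W" and c: "0 < c"
    and b: "\<And>Q. Q \<in> dyadic_subintervals Q0 \<Longrightarrow> 0 \<le> b Q"
    and summable: "\<And>L. L \<in> dyadic_subintervals Q0 \<Longrightarrow> b summable_on dyadic_subintervals L"
    and carleson: "\<And>L. L \<in> dyadic_subintervals Q0 \<Longrightarrow>
      (\<Sum>\<^sub>\<infinity>Q\<in>dyadic_subintervals L. b Q) \<le> c * measure lebesgue L"
    and K: "K \<in> dyadic_subintervals Q0"
  shows "a summable_on dyadic_subintervals K"
    and "(\<Sum>\<^sub>\<infinity>Q\<in>dyadic_subintervals K. a Q)
      \<le> 4 * c * measure lebesgue K * ((average W K *v u) \<bullet> u)"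
proof -
  define V where "V = (\<lambda>x. matrix_inv (W x))"
  define P where "P Q = (norm (inv_sqrt (average V Q) *v u))\<^sup>2" for Q
  define s where "s Q = (\<Sum>\<^sub>\<infinity>R\<in>dyadic_subintervals Q. b R)" for Q
  define M where "M Q = 1 + s Q / (c * measure lebesgue Q)" for Q
  define w where "w Q = (average W Q *v u) \<bullet> u" for Q
  define G where "G Q = 4 * c * measure lebesgue Q * (w Q - P Q / M Q)" for Q
  have a: "a Q = b Q * P Q" for Q by (simp add: a_def P_def V_def)
  have P: "0 \<le> P Q" for Q by (simp add: P_def)
  note wt = matrix_weight_average[OF W, folded V_def]
  have M: "1 \<le> M Q" "M Q \<le> 2" if Q: "Q \<in> dyadic_subintervals Q0" for Q
  proof -
    have pos: "0 < c * measure lebesgue Q"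
      using Q c by (auto simp: dyadic_subintervals_eq measure_dyadic)
    have "b R \<ge> 0" if "R \<in> dyadic_subintervals Q" for R
      using that Q b by (auto simp: dyadic_subintervals_def)
    then have "0 \<le> s Q" unfolding s_def by (rule infsum_nonneg)
    with pos show "1 \<le> M Q" by (simp add: M_def)
    show "M Q \<le> 2" using carleson[OF Q] pos by (simp add: M_def s_def)
  qed
  have Pw: "P (dyadic m j) \<le> w (dyadic m j)" if "dyadic m j \<subseteq> Q0" for m j
  proof -
    let ?R = "inv_sqrt (average V (dyadic m j))"
    have "2 * P (dyadic m j) \<le> P (dyadic m j) + w (dyadic m j)"
      using wt(5)[OF that, of u "?R *v (?R *v u)"]
        inv_sqrt_quad_variational(2,3)[OF wt(4)[OF that], of u]
      by (simp add: P_def w_def)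
    then show ?thesis by simp
  qed
  have G: "0 \<le> G Q \<and> G Q \<le> 4 * c * measure lebesgue Q * w Q"
    if Q: "Q \<in> dyadic_subintervals Q0" for Q
  proof -
    have "P Q / M Q \<le> P Q" using M[OF Q] P[of Q] by (simp add: divide_le_eq mult_le_cancel_left1)
    moreover have "P Q \<le> w Q" using Pw Q by (auto simp: dyadic_subintervals_eq)
    moreover have "0 \<le> P Q / M Q" using M[OF Q] P[of Q] by simp
    ultimately show ?thesis using c by (simp add: G_def mult_left_mono)
  qed
  have step: "a (dyadic m j) + G (dyadic (Suc m) (2 * j)) + G (dyadic (Suc m) (2 * j + 1))
      \<le> G (dyadic m j)" if I: "dyadic m j \<subseteq> Q0" for m j
  proof -
    let ?I = "dyadic m j" and ?L = "dyadic (Suc m) (2 * j)" and ?R = "dyadic (Suc m) (2 * j + 1)"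
    have L: "?L \<subseteq> Q0" and R: "?R \<subseteq> Q0" using dyadic_half_subset[of m j] I by auto
    have mem: "?I \<in> dyadic_subintervals Q0" "?L \<in> dyadic_subintervals Q0" "?R \<in> dyadic_subintervals Q0"
      using I L R by (simp_all add: dyadic_mem_subintervals)
    define \<beta> where "\<beta> = b ?I * 2 ^ m / c"
    have "0 \<le> b ?I" using b mem by simp
    then have \<beta>: "0 \<le> \<beta>" using c by (simp add: \<beta>_def)
    have "b ?I + s ?L + s ?R \<le> s ?I"
      unfolding s_def
      by (rule infsum_dyadic_split[OF summable[OF mem(1)]])
        (use b dyadic_subintervals_mono[OF I] in blast)
    moreover define k where "k = 2 ^ m / c"
    moreover have "0 \<le> k" using c by (simp add: k_def)
    ultimately have "(b ?I + s ?L + s ?R) * k \<le> s ?I * k"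
      by (intro mult_right_mono)
    then have "s ?L * k + s ?R * k + b ?I * k \<le> s ?I * k" by (simp add: distrib_right)
    moreover have "M ?I = 1 + s ?I * k" "\<beta> = b ?I * k"
      "M ?L = 1 + 2 * (s ?L * k)" "M ?R = 1 + 2 * (s ?R * k)"
      by (simp_all add: M_def \<beta>_def k_def measure_dyadic)
    ultimately have MM: "M ?L + M ?R + 2 * \<beta> \<le> 2 * M ?I"
      by simp
    have "P ?I / M ?I + \<beta> * P ?I / 4 \<le> (P ?L / M ?L + P ?R / M ?R) / 2"
      unfolding P_def
      by (rule bellman_step[OF wt(4)[OF I] wt(4)[OF L] wt(4)[OF R] average_split[OF wt(2)[OF I]]])
        (use M(1)[OF mem(2)] M(1)[OF mem(3)] M(2)[OF mem(1)] MM \<beta> in auto)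
    moreover have "w ?I = (w ?L + w ?R) / 2"
      unfolding w_def average_split[OF wt(1)[OF I]]
      by (simp add: matrix_scaleR_left matrix_vector_mult_add_rdistrib inner_add)
    ultimately have "\<beta> * P ?I / 4 + (w ?L - P ?L / M ?L) / 2 + (w ?R - P ?R / M ?R) / 2
        \<le> w ?I - P ?I / M ?I" by (simp add: field_simps)
    moreover define k where "k = 4 * c / 2 ^ m"
    moreover have "0 \<le> k" using c by (simp add: k_def)
    ultimately have "(\<beta> * P ?I / 4 + (w ?L - P ?L / M ?L) / 2 + (w ?R - P ?R / M ?R) / 2) * k
        \<le> (w ?I - P ?I / M ?I) * k"
      by (intro mult_right_mono)
    moreover have "\<beta> * P ?I / 4 * k = a ?I"
      using c by (simp add: \<beta>_def k_def a)
    moreover have "G ?I = (w ?I - P ?I / M ?I) * k" "G ?L = (w ?L - P ?L / M ?L) / 2 * k"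
      "G ?R = (w ?R - P ?R / M ?R) / 2 * k"
      by (simp_all add: G_def k_def measure_dyadic)
    ultimately show ?thesis by (simp only: distrib_right)
  qed
  obtain m j where mj: "K = dyadic m j" "dyadic m j \<subseteq> Q0"
    using K by (auto simp: dyadic_subintervals_eq)
  have "0 \<le> a Q" if "Q \<in> dyadic_subintervals Q0" for Q using b[OF that] P by (simp add: a)
  note * = dyadic_superadditive_summable[of m j a G, OF mj(2) this _ step, folded mj(1)]
  show "a summable_on dyadic_subintervals K" using *(1) G by blast
  show "(\<Sum>\<^sub>\<infinity>Q\<in>dyadic_subintervals K. a Q)
      \<le> 4 * c * measure lebesgue K * ((average W K *v u) \<bullet> u)"
    using *(2) G K unfolding w_def by (meson order_trans)
qed

section \<open>Replacing matrix Carleson sequences by scalar ones\<close>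

lemma inner_complex_smult: "(c *s x) \<bullet> (c *s y) = (norm c)\<^sup>2 * (x \<bullet> y)" for x y :: "complex^'n"
  unfolding cmod_power2
  by (simp add: inner_vec_def inner_complex_def power2_eq_square sum_distrib_left algebra_simps)

text \<open>Expand \<open>v\<close> into its \<open>d\<close> coordinate parts \<open>a i\<close> and bound each mixed term by
  \<open>(B x, y) \<le> ((B x, x) + (B y, y)) / 2\<close>; each diagonal term then occurs \<open>d\<close> times.\<close>
lemma psd_quad_le_trace:
  fixes B :: "complex^'n^'n"
  assumes "psd B"
  shows "quad_form B v \<le> CARD('n) * Re (trace B) * (norm v)\<^sup>2"
    and "0 \<le> quad_form B v" "0 \<le> Re (trace B)"
proof -
  have B: "selfadj B" "\<And>x. 0 \<le> (B *v x) \<bullet> x" using assms by (auto simp: psd_iff)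
  show "0 \<le> quad_form B v" by (simp add: quad_form_inner B)
  show tr: "0 \<le> Re (trace B)" by (simp add: trace_inner B sum_nonneg)
  define q where "q x = (B *v x) \<bullet> x" for x
  define a where "a i = v $ i *s axis i (1 :: complex)" for i
  have v: "v = (\<Sum>i\<in>UNIV. a i)"
    unfolding a_def by (simp add: basis_expansion)
  have amgm: "(B *v x) \<bullet> y \<le> (q x + q y) / 2" for x y
    using B(2)[of "x - y"] selfadj_mult_vec[OF B(1), of x y]
    by (simp add: q_def matrix_vector_mult_diff_distrib inner_diff inner_commute)
  have qa: "q (a i) \<le> (norm v)\<^sup>2 * q (axis i 1)" for i
  proof -
    have "q (a i) = (norm (v $ i))\<^sup>2 * q (axis i 1)"
      by (simp add: q_def a_def vector_scalar_commute inner_complex_smult)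
    also have "\<dots> \<le> (norm v)\<^sup>2 * q (axis i 1)"
      by (intro mult_right_mono power_mono) (auto simp: q_def B Finite_Cartesian_Product.norm_nth_le)
    finally show ?thesis .
  qed
  have "quad_form B v = (\<Sum>i\<in>UNIV. \<Sum>j\<in>UNIV. (B *v a i) \<bullet> a j)"
    unfolding quad_form_inner
    by (subst (1 2) v) (simp add: linear_sum[OF matrix_vector_mul_linear] inner_sum_left
        inner_sum_right sum.swap[of "\<lambda>i j. (B *v a i) \<bullet> a j"])
  also have "\<dots> \<le> (\<Sum>i\<in>(UNIV::'n set). \<Sum>j\<in>(UNIV::'n set). (q (a i) + q (a j)) / 2)"
    by (intro sum_mono amgm)
  also have "\<dots> = CARD('n) * (\<Sum>i\<in>UNIV. q (a i))"
    by (simp add: sum.distrib add_divide_distrib sum_divide_distrib[symmetric] sum_distrib_left[symmetric])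
  also have "\<dots> \<le> CARD('n) * (\<Sum>i\<in>UNIV. (norm v)\<^sup>2 * q (axis i 1))"
    by (intro mult_left_mono sum_mono qa) auto
  also have "\<dots> = CARD('n) * Re (trace B) * (norm v)\<^sup>2"
    by (simp add: trace_inner q_def sum_distrib_left mult_ac)
  finally show "quad_form B v \<le> CARD('n) * Re (trace B) * (norm v)\<^sup>2" .
qed

text \<open>Passing to the adjoint does not change the Frobenius norm, so the order of two
  self-adjoint factors does not matter for it. This lets one scalar estimate
  serve both orders of the factors.\<close>
lemma norm_selfadj_mult_swap:
  assumes "selfadj S" "selfadj T"
  shows "(norm ((S ** T) *v e))\<^sup>2 \<le> (\<Sum>i\<in>UNIV. (norm (T *v (S *v axis i 1)))\<^sup>2) * (norm e)\<^sup>2"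
proof -
  have "norm (S ** T) = norm (T ** S)"
    using norm_ctrans[of "S ** T"] assms by (simp add: ctrans_mult selfadj_ctrans)
  then have "(norm ((S ** T) *v e))\<^sup>2 \<le> (norm (T ** S) * norm e)\<^sup>2"
    using norm_matrix_vector_le[of "S ** T" e] by (intro power_mono) auto
  then show ?thesis
    by (simp add: power_mult_distrib norm_matrix_columns flip: matrix_vector_mul_assoc)
qed

lemma carleson_sequence_trace:
  fixes B :: "real set \<Rightarrow> complex^'n^'n" and C0 :: real
  assumes B: "carleson_sequence C0 B" and L: "L \<in> dyadic_subintervals Q0"
  shows "(\<lambda>Q. Re (trace (B Q))) summable_on dyadic_subintervals L"
    and "(\<Sum>\<^sub>\<infinity>Q\<in>dyadic_subintervals L. Re (trace (B Q))) \<le> CARD('n) * C0 * measure lebesgue L"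
proof -
  have bl: "bounded_linear (\<lambda>M :: complex^'n^'n. Re (trace M))"
    by (rule linear_conv_bounded_linear[THEN iffD1])
       (auto intro!: linearI simp: trace_def sum.distrib scaleR_sum_right sum_distrib_left)
  have summ: "B summable_on dyadic_subintervals L"
    and le: "psd (C0 *\<^sub>R mat 1 - (1 / measure lebesgue L) *\<^sub>R (\<Sum>\<^sub>\<infinity>Q\<in>dyadic_subintervals L. B Q))"
    using B L by (auto simp: carleson_sequence_def loewner_le_def)
  show "(\<lambda>Q. Re (trace (B Q))) summable_on dyadic_subintervals L"
    using summable_on_bounded_linear[OF bl summ] .
  have eq: "(\<Sum>\<^sub>\<infinity>Q\<in>dyadic_subintervals L. Re (trace (B Q)))
      = Re (trace (\<Sum>\<^sub>\<infinity>Q\<in>dyadic_subintervals L. B Q))"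
    by (rule infsumI[OF has_sum_bounded_linear[OF bl has_sum_infsum[OF summ]]])
  have pos: "0 < measure lebesgue L"
    using L by (auto simp: dyadic_subintervals_eq measure_dyadic)
  have "0 \<le> Re (trace (C0 *\<^sub>R mat 1 - (1 / measure lebesgue L) *\<^sub>R (\<Sum>\<^sub>\<infinity>Q\<in>dyadic_subintervals L. B Q)))"
    by (rule psd_quad_le_trace(3)[OF le])
  also have "\<dots> = CARD('n) * C0 - Re (trace (\<Sum>\<^sub>\<infinity>Q\<in>dyadic_subintervals L. B Q)) / measure lebesgue L"
    by (simp add: trace_def mat_def sum_subtractf sum_divide_distrib)
  finally show "(\<Sum>\<^sub>\<infinity>Q\<in>dyadic_subintervals L. Re (trace (B Q))) \<le> CARD('n) * C0 * measure lebesgue L"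
    using pos eq by (simp add: field_simps)
qed


section \<open>The weighted estimates\<close>

theorem theorem3p8:
  fixes C0 :: real
  assumes "C0 > 0"
  shows "\<exists>C::real. \<forall>B :: real set \<Rightarrow> complex^'n^'n. carleson_sequence C0 B \<longrightarrow>
    (\<forall>(W :: real \<Rightarrow> complex^'n^'n) (e :: complex^'n). \<forall>K\<in>dyadic_subintervals Q0.
      matrix_weight W \<longrightarrow>
      (let V = (\<lambda>x. matrix_inv (W x));
           f = (\<lambda>Q. quad_form (B Q) ((inv_sqrt (average W K) ** inv_sqrt (average V Q)) *v e));
           g = (\<lambda>Q. quad_form (B Q) ((inv_sqrt (average V Q) ** inv_sqrt (average W K)) *v e))
       in (f summable_on dyadic_subintervals K \<and>
           (1 / measure lebesgue K) * (\<Sum>\<^sub>\<infinity>Q\<in>dyadic_subintervals K. f Q) \<le> C * (norm e)\<^sup>2) \<and>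
          (g summable_on dyadic_subintervals K \<and>
           (1 / measure lebesgue K) * (\<Sum>\<^sub>\<infinity>Q\<in>dyadic_subintervals K. g Q) \<le> C * (norm e)\<^sup>2)))"
proof (rule exI[of _ "4 * C0 * CARD('n) ^ 3"], intro allI impI ballI)
  fix B :: "real set \<Rightarrow> complex^'n^'n" and W :: "real \<Rightarrow> complex^'n^'n" and e :: "complex^'n" and K
  assume B: "carleson_sequence C0 B" and K: "K \<in> dyadic_subintervals Q0" and W: "matrix_weight W"
  define V where "V = (\<lambda>x. matrix_inv (W x))"
  define R where "R Q = inv_sqrt (average V Q)" for Q
  define T where "T = inv_sqrt (average W K)"
  define b where "b Q = Re (trace (B Q))" for Q
  define n where "n = real CARD('n)"
  define E where "E u Q = b Q * (norm (R Q *v (T *v u)))\<^sup>2" for u :: "complex^'n" and Q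
  have n: "1 \<le> n" by (simp add: n_def)
  obtain m j where mj: "K = dyadic m j" "dyadic m j \<subseteq> Q0"
    using K by (auto simp: dyadic_subintervals_eq)
  have pos: "0 < measure lebesgue K" by (simp add: mj measure_dyadic)
  have psd: "psd (B Q)" if "Q \<in> dyadic_subintervals Q0" for Q
    using B that by (simp add: carleson_sequence_def)
  have inK: "Q \<in> dyadic_subintervals Q0" if "Q \<in> dyadic_subintervals K" for Q
    using that K by (auto simp: dyadic_subintervals_def)
  have posW: "posdef (average W K)"
    using matrix_weight_average(3)[OF W] mj by simp
  have sR: "selfadj (R Q)" if "Q \<in> dyadic_subintervals Q0" for Q
    using matrix_weight_average(4)[OF W] inv_sqrt_posdef(1) that
    by (auto simp: R_def V_def dyadic_subintervals_eq)
  have sT: "selfadj T" by (simp add: T_def inv_sqrt_posdef(1)[OF posW])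
  have Wu: "(average W K *v (T *v u)) \<bullet> (T *v u) = (norm u)\<^sup>2" for u
    by (simp add: T_def inv_sqrt_posdef(3)[OF posW] power2_norm_eq_inner)
  have E: "E u summable_on dyadic_subintervals K"
      "(\<Sum>\<^sub>\<infinity>Q\<in>dyadic_subintervals K. E u Q) \<le> 4 * (n * C0) * measure lebesgue K * (norm u)\<^sup>2" for u
    using weighted_carleson_embedding[OF W _ _ _ _ K, of "n * C0" b "T *v u"]
      psd_quad_le_trace(3)[OF psd] carleson_sequence_trace[OF B] assms n
    unfolding E_def R_def V_def b_def n_def Wu by auto
  \<comment> \<open>Both series are compared termwise with multiples of the scalar series \<open>E\<close>.\<close>
  have dominated: "f summable_on dyadic_subintervals K \<and>
      (1 / measure lebesgue K) * (\<Sum>\<^sub>\<infinity>Q\<in>dyadic_subintervals K. f Q) \<le> 4 * C0 * n ^ 3 * (norm e)\<^sup>2"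
    if f: "\<And>Q. Q \<in> dyadic_subintervals K \<Longrightarrow> 0 \<le> f Q" "\<And>Q. Q \<in> dyadic_subintervals K \<Longrightarrow> f Q \<le> h Q"
      and h: "(h has_sum s) (dyadic_subintervals K)"
        "s \<le> 4 * C0 * n ^ 3 * (norm e)\<^sup>2 * measure lebesgue K" for f h s
  proof
    have hs: "h summable_on dyadic_subintervals K" using h(1) by (auto simp: summable_on_def)
    show fs: "f summable_on dyadic_subintervals K"
      by (rule summable_on_comparison_test[OF hs]) (use f in auto)
    have "(\<Sum>\<^sub>\<infinity>Q\<in>dyadic_subintervals K. f Q) \<le> (\<Sum>\<^sub>\<infinity>Q\<in>dyadic_subintervals K. h Q)"
      using f by (intro infsum_mono fs hs) auto
    then show "(1 / measure lebesgue K) * (\<Sum>\<^sub>\<infinity>Q\<in>dyadic_subintervals K. f Q) \<le> 4 * C0 * n ^ 3 * (norm e)\<^sup>2"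
      using h(2) infsumI[OF h(1)] pos by (simp add: divide_le_eq)
  qed
  have hE: "(E u has_sum (\<Sum>\<^sub>\<infinity>Q\<in>dyadic_subintervals K. E u Q)) (dyadic_subintervals K)" for u
    using E(1) by (rule has_sum_infsum)
  have hEs: "((\<lambda>Q. \<Sum>i\<in>I. E (u i) Q) has_sum (\<Sum>i\<in>I. \<Sum>\<^sub>\<infinity>Q\<in>dyadic_subintervals K. E (u i) Q))
      (dyadic_subintervals K)" for u :: "'n \<Rightarrow> complex^'n" and I
    by (induction I rule: infinite_finite_induct) (auto intro!: has_sum_add hE)
  have b: "0 \<le> b Q" if "Q \<in> dyadic_subintervals K" for Q
    using psd_quad_le_trace(3)[OF psd[OF inK[OF that]]] by (simp add: b_def)
  have g: "quad_form (B Q) ((R Q ** T) *v e) \<le> n * E e Q" if "Q \<in> dyadic_subintervals K" for Q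
    using psd_quad_le_trace(1)[OF psd[OF inK[OF that]], of "(R Q ** T) *v e"]
    by (simp add: E_def b_def n_def mult_ac flip: matrix_vector_mul_assoc)
  have f: "quad_form (B Q) ((T ** R Q) *v e) \<le> n * (norm e)\<^sup>2 * (\<Sum>i\<in>UNIV. E (axis i 1) Q)"
    if Q: "Q \<in> dyadic_subintervals K" for Q
  proof -
    have "quad_form (B Q) ((T ** R Q) *v e) \<le> n * b Q * (norm ((T ** R Q) *v e))\<^sup>2"
      using psd_quad_le_trace(1)[OF psd[OF inK[OF Q]]] by (simp add: n_def b_def)
    also have "\<dots> \<le> n * b Q * ((\<Sum>i\<in>UNIV. (norm (R Q *v (T *v axis i 1)))\<^sup>2) * (norm e)\<^sup>2)"
      using n b[OF Q] by (intro mult_left_mono norm_selfadj_mult_swap sT sR inK Q) auto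
    also have "\<dots> = n * (norm e)\<^sup>2 * (\<Sum>i\<in>UNIV. E (axis i 1) Q)"
      by (simp add: E_def sum_distrib_left mult_ac)
    finally show ?thesis .
  qed
  \<comment> \<open>One factor \<open>n\<close> comes from the trace bound and one from the Carleson constant; the first series
    has a third one from summing over all coordinate vectors, and the common constant has all three.\<close>
  have n3: "n * n \<le> n ^ 3" using n by (simp add: power3_eq_cube)
  have "(\<Sum>i\<in>(UNIV :: 'n set). \<Sum>\<^sub>\<infinity>Q\<in>dyadic_subintervals K. E (axis i 1) Q)
      \<le> (\<Sum>i\<in>(UNIV :: 'n set). 4 * (n * C0) * measure lebesgue K)"
    using E(2)[of "axis _ 1"] by (intro sum_mono) simp
  then have fin: "n * (norm e)\<^sup>2 * (\<Sum>i\<in>(UNIV :: 'n set). \<Sum>\<^sub>\<infinity>Q\<in>dyadic_subintervals K. E (axis i 1) Q)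
      \<le> n * (norm e)\<^sup>2 * (n * (4 * (n * C0) * measure lebesgue K))"
    using n by (intro mult_left_mono) (auto simp: n_def)
  have "n * (\<Sum>\<^sub>\<infinity>Q\<in>dyadic_subintervals K. E e Q) \<le> n * (4 * (n * C0) * measure lebesgue K * (norm e)\<^sup>2)"
    using E(2)[of e] n by (intro mult_left_mono) auto
  also have "\<dots> = n * n * (4 * C0 * measure lebesgue K * (norm e)\<^sup>2)" by (simp add: mult_ac)
  also have "\<dots> \<le> n ^ 3 * (4 * C0 * measure lebesgue K * (norm e)\<^sup>2)"
    using n3 assms by (intro mult_right_mono) auto
  finally have gin: "n * (\<Sum>\<^sub>\<infinity>Q\<in>dyadic_subintervals K. E e Q) \<le> 4 * C0 * n ^ 3 * (norm e)\<^sup>2 * measure lebesgue K"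
    by (simp add: mult_ac)
  have fin': "n * (norm e)\<^sup>2 * (\<Sum>i\<in>(UNIV :: 'n set). \<Sum>\<^sub>\<infinity>Q\<in>dyadic_subintervals K. E (axis i 1) Q)
    \<le> 4 * C0 * n ^ 3 * (norm e)\<^sup>2 * measure lebesgue K"
    using fin by (simp add: power3_eq_cube mult_ac)
  have quad: "quad_form (B Q) v \<ge> 0" if "Q \<in> dyadic_subintervals K" for Q v
    using psd_quad_le_trace(2)[OF psd[OF inK[OF that]]] .
  from dominated[OF quad f has_sum_cmult_right[OF hEs] fin']
    dominated[OF quad g has_sum_cmult_right[OF hE] gin]
  show "let V = (\<lambda>x. matrix_inv (W x));
           f = (\<lambda>Q. quad_form (B Q) ((inv_sqrt (average W K) ** inv_sqrt (average V Q)) *v e));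
           g = (\<lambda>Q. quad_form (B Q) ((inv_sqrt (average V Q) ** inv_sqrt (average W K)) *v e))
       in (f summable_on dyadic_subintervals K \<and>
           (1 / measure lebesgue K) * (\<Sum>\<^sub>\<infinity>Q\<in>dyadic_subintervals K. f Q) \<le> 4 * C0 * CARD('n) ^ 3 * (norm e)\<^sup>2) \<and>
          (g summable_on dyadic_subintervals K \<and>
           (1 / measure lebesgue K) * (\<Sum>\<^sub>\<infinity>Q\<in>dyadic_subintervals K. g Q) \<le> 4 * C0 * CARD('n) ^ 3 * (norm e)\<^sup>2)"
    unfolding Let_def R_def T_def V_def n_def by simp
qed

end
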